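(* Let $G=(\{1,\dots,n\},E)$ be a finite simple graph with complement $\overline G$, and define $$\vartheta^{\ell}(G)=\max\Big\{\sum_{i=1}^n (e_1\cdot u^i)^2:\ \{u^1,\dots,u^n\}\text{ is an orthonormal representation of }\overline G\Big\},$$ where $e_1=[1\ 0\ \cdots\ 0]^\top$ is the first canonical basis vector. Then $\vartheta^{\ell}(G)=\vartheta(G)$, the Lovász theta number of $G$.
   Context: An orthonormal representation of $\overline G$ is a family of unit vectors $u^1,\dots,u^n$ (in a common space $\mathbb{R}^k$, for some $k\ge1$) such that $u^i\cdot u^j=0$ for all $\{i,j\}\in E$; $e_1$ is the first canonical vector of the same space. The Lovász theta number $\vartheta(G)$ is defined as the optimum value of $$\min\big\{t:\ \overline z_{ii}=t-1\ \forall i,\ \ \overline z_{ij}=-1\ \forall\{i,j\}\notin E\ (i\ne j),\ \ \overline Z\succeq 0\big\},$$ over $t\in\mathbb{R}$ and real symmetric $\overline Z=(\overline z_{ij})\in\mathbb{R}^{n\times n}$, where $\succeq0$ means positive semidefinite. *)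

theory Defs
  imports "HOL-Analysis.Analysis" "Jordan_Normal_Form.Matrix"
begin

text \<open>
  A graph on a finite vertex type \<open>'v\<close> is given by its set \<open>E\<close> of two-element edges.
  The dimension \<open>k\<close> of the ambient space of a representation is quantified inside the definition
  of the optimisation problem, so these vectors are taken from \<^theory>\<open>Jordan_Normal_Form.Matrix\<close>;
  coordinates there start at 0, hence the first canonical vector is \<open>unit_vec k 0\<close>.
\<close>

definition orthonormal_rep_complement ::
    "'v::finite set set \<Rightarrow> nat \<Rightarrow> ('v \<Rightarrow> real Matrix.vec) \<Rightarrow> bool" where
  "orthonormal_rep_complement E k u \<longleftrightarrow>
     k \<ge> 1 \<and>
     (\<forall>i. u i \<in> carrier_vec k \<and> scalar_prod (u i) (u i) = 1) \<and>
     (\<forall>i j. {i, j} \<in> E \<longrightarrow> scalar_prod (u i) (u j) = 0)"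

definition theta_ell_values :: "'v::finite set set \<Rightarrow> real set" where
  "theta_ell_values E =
     {(\<Sum>i\<in>UNIV. (scalar_prod (unit_vec k 0) (u i))\<^sup>2) | k u. orthonormal_rep_complement E k u}"

definition theta_ell :: "'v::finite set set \<Rightarrow> real" where
  "theta_ell E = (GREATEST s. s \<in> theta_ell_values E)"

definition pos_semidef :: "real^'v^'v \<Rightarrow> bool" where
  "pos_semidef Z \<longleftrightarrow> transpose Z = Z \<and> (\<forall>x. inner x (Z *v x) \<ge> 0)"

definition theta_values :: "'v::finite set set \<Rightarrow> real set" where
  "theta_values E =
     {t. \<exists>Z :: real^'v^'v.
           (\<forall>i. vec_nth (vec_nth Z i) i = t - 1) \<and>
           (\<forall>i j. i \<noteq> j \<and> {i, j} \<notin> E \<longrightarrow> vec_nth (vec_nth Z i) j = - 1) \<and>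
           pos_semidef Z}"

definition lovasz_theta :: "'v::finite set set \<Rightarrow> real" where
  "lovasz_theta E = (LEAST t. t \<in> theta_values E)"

text \<open>
  \<open>GREATEST\<close> and \<open>LEAST\<close> are meaningful only where the optimum is attained;
  statements about \<^const>\<open>theta_ell\<close> and \<^const>\<open>lovasz_theta\<close> should therefore be
  accompanied by \<open>is_maximum\<close> and \<open>is_minimum\<close>.
\<close>

definition is_maximum :: "real set \<Rightarrow> real \<Rightarrow> bool" where
  "is_maximum S m \<longleftrightarrow> m \<in> S \<and> (\<forall>s\<in>S. s \<le> m)"

definition is_minimum :: "real set \<Rightarrow> real \<Rightarrow> bool" where
  "is_minimum S m \<longleftrightarrow> m \<in> S \<and> (\<forall>s\<in>S. m \<le> s)"

end

theory Submission imports Defs begin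

text \<open>
  Semidefinite weak duality gives \<open>\<vartheta>\<^sup>\<ell> \<le> \<vartheta>\<close>. Conversely, let \<open>t\<close> be the minimum defining \<open>\<vartheta>\<close>, attained by
  compactness. The point \<open>(0, t)\<close> lies in the convex hull of the vectors consisting of the products
  \<open>x\<^sub>i x\<^sub>j\<close> for edges \<open>{i, j}\<close> together with \<open>(\<Sum>\<^sub>i x\<^sub>i)\<^sup>2\<close>, where \<open>|x| = 1\<close>: a separating hyperplane would give
  a feasible matrix with a value below \<open>t\<close>. The weights of a convex combination are the squared
  scaling factors of a Gram representation, whose normalised vectors, measured against the
  normalised sum, form an orthonormal representation of value at least \<open>t\<close>.
\<close>

no_notation Matrix.vec_index (infixl "$" 100)
no_notation Matrix.scalar_prod (infix "\<bullet>" 70)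

section \<open>Positive semidefiniteness through quadratic forms\<close>

text \<open>The argument is a plain function, so test vectors can be written directly as lambda
  terms.\<close>

definition quad :: "real^'v^'v \<Rightarrow> ('v::finite \<Rightarrow> real) \<Rightarrow> real" where
  "quad Z x = (\<Sum>i\<in>UNIV. \<Sum>j\<in>UNIV. Z $ i $ j * x i * x j)"

lemma pos_semidef_iff_quad:
  "pos_semidef Z \<longleftrightarrow> (\<forall>i j. Z $ i $ j = Z $ j $ i) \<and> (\<forall>x. 0 \<le> quad Z x)"
proof -
  have "inner x (Z *v x) = quad Z (vec_nth x)" for x
    by (simp add: quad_def inner_vec_def matrix_vector_mult_def sum_distrib_left algebra_simps)
  moreover have "(\<forall>x. 0 \<le> quad Z (vec_nth x)) \<longleftrightarrow> (\<forall>x. 0 \<le> quad Z x)"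
  proof safe
    fix x assume "\<forall>x. 0 \<le> quad Z (vec_nth x)"
    then show "0 \<le> quad Z x"
      by (metis vec_lambda_inverse UNIV_I)
  qed blast
  moreover have "transpose Z = Z \<longleftrightarrow> (\<forall>i j. Z $ i $ j = Z $ j $ i)"
    unfolding Finite_Cartesian_Product.transpose_def Finite_Cartesian_Product.vec_eq_iff vec_lambda_beta
    by metis
  ultimately show ?thesis
    by (simp add: pos_semidef_def)
qed

lemma quad_two_points:
  assumes "p \<noteq> q"
  shows "quad Z (\<lambda>i. if i = p then a else if i = q then b else 0) =
    Z $ p $ p * a\<^sup>2 + Z $ p $ q * a * b + Z $ q $ p * a * b + Z $ q $ q * b\<^sup>2"
proof -
  let ?x = "\<lambda>i. if i = p then a else if i = q then b else 0"
  have two: "(\<Sum>i\<in>UNIV. f i) = f p + f q" if "\<And>i. i \<noteq> p \<Longrightarrow> i \<noteq> q \<Longrightarrow> f i = 0" for f :: "'a \<Rightarrow> real"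
  proof -
    have "(\<Sum>i\<in>UNIV. f i) = (\<Sum>i\<in>{p, q}. f i)"
      by (rule sum.mono_neutral_right) (use that in auto)
    then show ?thesis using assms by simp
  qed
  have "quad Z ?x = (\<Sum>j\<in>UNIV. Z $ p $ j * ?x p * ?x j) + (\<Sum>j\<in>UNIV. Z $ q $ j * ?x q * ?x j)"
    unfolding quad_def by (subst two) auto
  also have "(\<Sum>j\<in>UNIV. Z $ p $ j * ?x p * ?x j) = Z $ p $ p * a * a + Z $ p $ q * a * b"
    using assms by (subst two) auto
  also have "(\<Sum>j\<in>UNIV. Z $ q $ j * ?x q * ?x j) = Z $ q $ p * b * a + Z $ q $ q * b * b"
    using assms by (subst two) auto
  finally show ?thesis by (simp add: power2_eq_square algebra_simps)
qed

lemma pos_semidef_diagonal_nonneg: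
  assumes "pos_semidef Z"
  shows "0 \<le> Z $ p $ p"
proof -
  have "quad Z (\<lambda>i. if i = p then 1 else 0) = (\<Sum>i\<in>UNIV. if i = p then Z $ p $ p else 0)"
    unfolding quad_def
    by (rule sum.cong[OF refl]) (auto simp: if_distrib[where f = "\<lambda>y. _ * y"] cong: if_cong)
  then show ?thesis
    using assms by (auto simp: pos_semidef_iff_quad dest: spec[of _ "\<lambda>i. if i = p then 1 else 0"])
qed

text \<open>Testing with the sum and the difference of the basis vectors at \<open>p\<close> and
  \<open>q\<close> gives \<open>0 \<le> 2 * d + 2 * Z $ p $ q\<close> and
  \<open>0 \<le> 2 * d - 2 * Z $ p $ q\<close>. This will bound the feasible matrices.\<close>

lemma pos_semidef_entry_bound:
  assumes "pos_semidef Z" and "Z $ p $ p = d" and "Z $ q $ q = d"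
  shows "\<bar>Z $ p $ q\<bar> \<le> d"
proof (cases "p = q")
  case True
  then show ?thesis using assms pos_semidef_diagonal_nonneg[of Z p] by auto
next
  case False
  have "0 \<le> quad Z (\<lambda>i. if i = p then 1 else if i = q then b else 0)" for b
    using assms(1) by (simp add: pos_semidef_iff_quad)
  from this[of 1] this[of "-1"] show ?thesis
    using assms unfolding quad_two_points[OF False]
    by (auto simp: pos_semidef_iff_quad)
qed

section \<open>Attainment of the minimum\<close>

lemma theta_values_ge_1:
  assumes "t \<in> theta_values (E :: 'v::finite set set)"
  shows "1 \<le> t"
proof -
  obtain Z :: "real^'v^'v" where "\<forall>i. Z $ i $ i = t - 1" and "pos_semidef Z"
    using assms by (auto simp: theta_values_def)
  then show ?thesis
    using pos_semidef_diagonal_nonneg[of Z undefined] by simp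
qed

text \<open>With n vertices, the matrix nI - J (J all ones) is feasible: it is positive semidefinite
  because the square of a sum of n terms is at most n times the sum of their squares.\<close>

lemma card_mem_theta_values:
  "real CARD('v) \<in> theta_values (E :: 'v::finite set set)"
proof -
  define Z :: "real^'v^'v" where "Z = (\<chi> i j. (if i = j then real CARD('v) else 0) - 1)"
  have "0 \<le> quad Z x" for x
  proof -
    have "quad Z x = (\<Sum>i\<in>UNIV. \<Sum>j\<in>UNIV. (if i = j then real CARD('v) * (x i)\<^sup>2 else 0) - x i * x j)"
      unfolding quad_def Z_def by (intro sum.cong refl) (auto simp: algebra_simps power2_eq_square)
    also have "\<dots> = real CARD('v) * (\<Sum>i\<in>UNIV. (x i)\<^sup>2) - (\<Sum>i\<in>UNIV. x i)\<^sup>2"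
      unfolding sum_subtractf power2_eq_square[of "sum x UNIV"] sum_product by (simp add: sum_distrib_left)
    finally show ?thesis
      using sum_squared_le_sum_of_squares[of x UNIV] by (simp add: mult.commute)
  qed
  then have "pos_semidef Z"
    by (auto simp: pos_semidef_iff_quad Z_def)
  then show ?thesis
    unfolding theta_values_def by (auto intro!: exI[of _ Z] simp: Z_def)
qed

lemma theta_values_has_minimum:
  obtains t where "is_minimum (theta_values (E :: 'v::finite set set)) t"
proof -
  obtain p :: 'v where True by simp
  let ?n = "real CARD('v)"
  \<comment> \<open>The value t is encoded as \<open>Z $ p $ p + 1\<close>, so that only matrices
    remain. The cap at \<open>?n - 1\<close> makes \<open>K\<close> bounded and loses nothing, since
    the value \<open>?n\<close> is feasible.\<close>
  define K where "K = {Z :: real^'v^'v. (\<forall>i. Z $ i $ i = Z $ p $ p) \<and> Z $ p $ p \<le> ?n - 1 \<and>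
    (\<forall>i j. i \<noteq> j \<and> {i, j} \<notin> E \<longrightarrow> Z $ i $ j = - 1) \<and> pos_semidef Z}"
  have "closed K"
    unfolding K_def pos_semidef_iff_quad quad_def
    by (intro closed_Collect_conj closed_Collect_all closed_Collect_imp closed_Collect_eq closed_Collect_le
        open_Collect_const continuous_intros)
  moreover have "bounded K"
  proof (rule boundedI)
    fix Z assume Z: "Z \<in> K"
    have "norm Z \<le> (\<Sum>i\<in>UNIV. norm (Z $ i))"
      by (simp add: norm_vec_def L2_set_le_sum)
    also have "\<dots> \<le> (\<Sum>i\<in>UNIV. \<Sum>j\<in>UNIV. \<bar>Z $ i $ j\<bar>)"
      by (intro sum_mono norm_le_l1_cart)
    also have "\<dots> \<le> (\<Sum>i\<in>(UNIV :: 'v set). \<Sum>j\<in>(UNIV :: 'v set). ?n - 1)"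
    proof (intro sum_mono)
      fix i j
      show "\<bar>Z $ i $ j\<bar> \<le> ?n - 1"
        using Z pos_semidef_entry_bound[of Z i "Z $ p $ p" j] unfolding K_def by force
    qed
    finally show "norm Z \<le> (\<Sum>i\<in>(UNIV :: 'v set). \<Sum>j\<in>(UNIV :: 'v set). ?n - 1)" .
  qed
  ultimately have "compact K"
    by (simp add: compact_eq_bounded_closed)
  have K_iff: "(\<exists>Z\<in>K. Z $ p $ p = t - 1) \<longleftrightarrow> t \<in> theta_values E \<and> t \<le> ?n" for t
    unfolding K_def theta_values_def by fastforce
  have "K \<noteq> {}"
    using K_iff[of ?n] card_mem_theta_values[where E = E] by auto
  moreover have "continuous_on K (\<lambda>Z. Z $ p $ p)"
    by (intro continuous_intros)
  ultimately obtain Z where Z: "Z \<in> K" "\<And>Y. Y \<in> K \<Longrightarrow> Z $ p $ p \<le> Y $ p $ p"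
    using continuous_attains_inf[OF \<open>compact K\<close>] by blast
  have "is_minimum (theta_values E) (Z $ p $ p + 1)"
    unfolding is_minimum_def
  proof
    show mem: "Z $ p $ p + 1 \<in> theta_values E"
      using K_iff[of "Z $ p $ p + 1"] Z(1) by auto
    show "\<forall>s\<in>theta_values E. Z $ p $ p + 1 \<le> s"
    proof
      fix s assume s: "s \<in> theta_values E"
      show "Z $ p $ p + 1 \<le> s"
      proof (cases "s \<le> ?n")
        case True
        then obtain Y where "Y \<in> K" "Y $ p $ p = s - 1"
          using s K_iff by blast
        then show ?thesis using Z(2)[of Y] by simp
      next
        case False
        then show ?thesis using Z(1) unfolding K_def by auto
      qed
    qed
  qed
  then show thesis by (rule that)
qed

section \<open>Weak duality\<close>

text \<open>
  The Schur product of \<open>Z\<close> with the Gram matrix of the vectors \<open>(e\<^sub>1 \<cdot> u\<^sub>i) u\<^sub>i\<close> no longer sees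
  the free entries of \<open>Z\<close>, and the sum of its entries is nonnegative.
\<close>

lemma theta_ell_le_theta:
  fixes E :: "'v::finite set set"
  assumes s: "s \<in> theta_ell_values E" and t: "t \<in> theta_values E"
  shows "s \<le> t"
proof -
  obtain k u where rep: "orthonormal_rep_complement E k u"
    and s_eq: "s = (\<Sum>i\<in>UNIV. (scalar_prod (unit_vec k 0) (u i))\<^sup>2)"
    using s unfolding theta_ell_values_def by blast
  obtain Z :: "real^'v^'v" where diag: "\<And>i. Z $ i $ i = t - 1"
    and off: "\<And>i j. i \<noteq> j \<Longrightarrow> {i, j} \<notin> E \<Longrightarrow> Z $ i $ j = - 1" and psd: "pos_semidef Z"
    using t unfolding theta_values_def by auto
  define w where "w i m = vec_index (u i) m" for i m
  define x where "x i = w i 0" for i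
  have k: "0 < k" and dim: "u i \<in> carrier_vec k" for i
    using rep by (auto simp: orthonormal_rep_complement_def)
  have sp: "scalar_prod (u i) (u j) = (\<Sum>m<k. w i m * w j m)" for i j
    using dim[of j] by (simp add: scalar_prod_def w_def atLeast0LessThan)
  have norm1: "(\<Sum>m<k. w i m * w i m) = 1" for i
    using rep sp[of i i] by (auto simp: orthonormal_rep_complement_def)
  have orth: "(\<Sum>m<k. w i m * w j m) = 0" if "{i, j} \<in> E" for i j
    using rep sp[of i j] that by (auto simp: orthonormal_rep_complement_def)
  have s_x: "s = (\<Sum>i\<in>UNIV. (x i)\<^sup>2)"
    using scalar_prod_left_unit[OF dim k] by (simp add: s_eq x_def w_def)
  \<comment> \<open>For the Gram matrix G of the \<open>u i\<close>, the Schur product of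
    \<open>Z\<close> and G equals tI - G: the diagonal of G is 1, \<open>Z\<close> is -1 at
    non-edges, and G vanishes at edges, where \<open>Z\<close> is free.\<close>
  have entry: "Z $ i $ j * (\<Sum>m<k. w i m * w j m) = (if i = j then t else 0) - (\<Sum>m<k. w i m * w j m)" for i j
    using diag[of i] off[of i j] norm1[of i] orth[of i j] by (cases "i = j"; cases "{i, j} \<in> E") auto
  have "0 \<le> (\<Sum>m<k. quad Z (\<lambda>i. x i * w i m))"
    using psd by (intro sum_nonneg) (simp add: pos_semidef_iff_quad)
  also have "\<dots> = (\<Sum>i\<in>UNIV. \<Sum>m<k. \<Sum>j\<in>UNIV. Z $ i $ j * (x i * w i m) * (x j * w j m))"
    unfolding quad_def by (rule sum.swap)
  also have "\<dots> = (\<Sum>i\<in>UNIV. \<Sum>j\<in>UNIV. \<Sum>m<k. Z $ i $ j * (x i * w i m) * (x j * w j m))"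
    by (intro sum.cong refl sum.swap)
  also have "\<dots> = (\<Sum>i\<in>UNIV. \<Sum>j\<in>UNIV. x i * x j * (Z $ i $ j * (\<Sum>m<k. w i m * w j m)))"
    by (intro sum.cong refl) (simp add: sum_distrib_left mult_ac)
  also have "\<dots> = (\<Sum>i\<in>UNIV. \<Sum>j\<in>UNIV. (if i = j then t * (x i)\<^sup>2 else 0)
      - (\<Sum>m<k. (x i * w i m) * (x j * w j m)))"
    unfolding entry
    by (intro sum.cong refl) (auto simp: sum_distrib_left algebra_simps power2_eq_square)
  also have "\<dots> = t * s - (\<Sum>i\<in>UNIV. \<Sum>j\<in>UNIV. \<Sum>m<k. (x i * w i m) * (x j * w j m))"
    by (simp add: sum_subtractf s_x sum_distrib_left)
  also have "(\<Sum>i\<in>UNIV. \<Sum>j\<in>UNIV. \<Sum>m<k. (x i * w i m) * (x j * w j m))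
      = (\<Sum>i\<in>UNIV. \<Sum>m<k. \<Sum>j\<in>UNIV. (x i * w i m) * (x j * w j m))"
    by (intro sum.cong refl sum.swap)
  also have "\<dots> = (\<Sum>m<k. \<Sum>i\<in>UNIV. \<Sum>j\<in>UNIV. (x i * w i m) * (x j * w j m))"
    by (rule sum.swap)
  also have "\<dots> = (\<Sum>m<k. (\<Sum>i\<in>UNIV. x i * w i m)\<^sup>2)"
    by (simp add: power2_eq_square sum_product)
  finally have "(\<Sum>m<k. (\<Sum>i\<in>UNIV. x i * w i m)\<^sup>2) \<le> t * s"
    by simp
  \<comment> \<open>Only coordinate 0 is kept, where \<open>x i * w i 0\<close> is the square of
    \<open>x i\<close> and the sum is therefore \<open>s\<close>.\<close>
  moreover have "(\<Sum>i\<in>UNIV. x i * w i 0)\<^sup>2 \<le> (\<Sum>m<k. (\<Sum>i\<in>UNIV. x i * w i m)\<^sup>2)"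
    using k by (intro member_le_sum) auto
  moreover have "(\<Sum>i\<in>UNIV. x i * w i 0) = s"
    by (simp add: s_x x_def power2_eq_square)
  ultimately have "s * s \<le> t * s"
    by (simp add: power2_eq_square)
  moreover have "0 \<le> s"
    by (simp add: s_x sum_nonneg)
  moreover have "1 \<le> t"
    using t by (rule theta_values_ge_1)
  ultimately show ?thesis
    by (cases "s = 0") (auto simp: mult_le_cancel_right)
qed

section \<open>From Gram matrices to orthonormal representations\<close>

text \<open>
  The isometry \<open>y \<mapsto> (c \<cdot> y, y - (c \<cdot> y) c)\<close> takes the unit vector \<open>c\<close> to the first canonical vector.
\<close>

lemma theta_ell_valuesI:
  fixes E :: "'v::finite set set" and c :: "'b \<Rightarrow> real"
  assumes fin: "finite I"
    and c: "(\<Sum>m\<in>I. (c m)\<^sup>2) = 1"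
    and w: "\<And>i. (\<Sum>m\<in>I. (w i m)\<^sup>2) = 1"
    and orth: "\<And>i j. {i, j} \<in> E \<Longrightarrow> (\<Sum>m\<in>I. w i m * w j m) = 0"
  shows "(\<Sum>i\<in>UNIV. (\<Sum>m\<in>I. c m * w i m)\<^sup>2) \<in> theta_ell_values E"
proof -
  obtain f where f: "bij_betw f {0..<card I} I"
    using ex_bij_betw_nat_finite[OF fin] by blast
  define a where "a i = (\<Sum>m\<in>I. c m * w i m)" for i
  define r where "r i m = w i m - a i * c m" for i m
  define u where "u i = Matrix.vec (Suc (card I)) (\<lambda>p. if p = 0 then a i else r i (f (p - 1)))" for i
  have sp: "scalar_prod (u i) (u j) = (\<Sum>m\<in>I. w i m * w j m)" for i j
  proof -
    have "scalar_prod (u i) (u j) = a i * a j + (\<Sum>p = 0..<card I. r i (f p) * r j (f p))"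
      by (simp add: scalar_prod_def u_def sum.atLeast0_lessThan_Suc_shift del: sum.op_ivl_Suc)
    also have "(\<Sum>p = 0..<card I. r i (f p) * r j (f p)) = (\<Sum>m\<in>I. r i m * r j m)"
      by (rule sum.reindex_bij_betw[OF f])
    \<comment> \<open>As \<open>c\<close> is a unit vector, the correction terms add up to
      \<open>- a i * a j\<close>, which cancels the contribution of the new coordinate 0.\<close>
    also have "\<dots> = (\<Sum>m\<in>I. w i m * w j m - a j * (c m * w i m) - a i * (c m * w j m) + a i * a j * (c m)\<^sup>2)"
      by (intro sum.cong refl) (simp add: r_def algebra_simps power2_eq_square)
    also have "\<dots> = (\<Sum>m\<in>I. w i m * w j m) - a j * a i - a i * a j + a i * a j * 1"
      unfolding sum.distrib sum_subtractf sum_distrib_left[symmetric] c a_def by simp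
    finally show ?thesis by simp
  qed
  have "orthonormal_rep_complement E (Suc (card I)) u"
    unfolding orthonormal_rep_complement_def sp
    using w orth by (auto simp: u_def power2_eq_square)
  moreover have "scalar_prod (unit_vec (Suc (card I)) 0) (u i) = a i" for i
    by (subst scalar_prod_left_unit[of _ "Suc (card I)"]) (auto simp: u_def)
  ultimately show ?thesis
    unfolding theta_ell_values_def a_def[symmetric]
    by (auto intro!: exI[of _ "Suc (card I)"] exI[of _ u])
qed

text \<open>
  The vectors \<open>v\<^sub>i\<close> have a Gram matrix that is feasible for the semidefinite dual. Normalising them
  loses nothing by the Cauchy--Schwarz inequality; a vanishing \<open>v\<^sub>i\<close> is replaced by a unit vector in
  a fresh direction.
\<close>

lemma theta_ell_values_of_gram:
  fixes E :: "'v::finite set set" and v :: "'v \<Rightarrow> 'b \<Rightarrow> real"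
  assumes card2: "\<forall>e\<in>E. card e = 2" and fin: "finite I"
    and tr: "(\<Sum>i\<in>UNIV. \<Sum>m\<in>I. (v i m)\<^sup>2) = 1"
    and orth: "\<And>i j. {i, j} \<in> E \<Longrightarrow> (\<Sum>m\<in>I. v i m * v j m) = 0"
    and t: "(\<Sum>m\<in>I. (\<Sum>i\<in>UNIV. v i m)\<^sup>2) = t" and t_pos: "0 < t"
  obtains s where "s \<in> theta_ell_values E" and "t \<le> s"
proof -
  define n where "n i = sqrt (\<Sum>m\<in>I. (v i m)\<^sup>2)" for i
  have n2: "(n i)\<^sup>2 = (\<Sum>m\<in>I. (v i m)\<^sup>2)" for i
    unfolding n_def by (simp add: sum_nonneg)
  have n0: "v i m = 0" if "n i = 0" "m \<in> I" for i m
    using n2[of i] that fin by (simp add: sum_nonneg_eq_0_iff)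
  \<comment> \<open>Each vertex contributes a private coordinate. A vanishing \<open>v i\<close> is
    replaced by the unit vector there, which is orthogonal to all other \<open>w j\<close> and to
    \<open>c\<close>.\<close>
  define J where "J = I <+> (UNIV :: 'v set)"
  define w where "w i = (\<lambda>Inl m \<Rightarrow> v i m / n i | Inr j \<Rightarrow> if n i = 0 \<and> j = i then 1 else 0)" for i
  define c where "c = (\<lambda>Inl m \<Rightarrow> (\<Sum>i\<in>UNIV. v i m) / sqrt t | Inr (j :: 'v) \<Rightarrow> 0)"
  have sumJ: "(\<Sum>m\<in>J. g m) = (\<Sum>m\<in>I. g (Inl m)) + (\<Sum>j\<in>UNIV. g (Inr j))" for g :: "'b + 'v \<Rightarrow> real"
    unfolding J_def using fin by (subst sum.Plus) auto
  define s where "s = (\<Sum>i\<in>UNIV. (\<Sum>m\<in>J. c m * w i m)\<^sup>2)"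
  have "s \<in> theta_ell_values E"
    unfolding s_def
  proof (rule theta_ell_valuesI)
    show "finite J" using fin by (simp add: J_def)
    show "(\<Sum>m\<in>J. (c m)\<^sup>2) = 1"
      using t t_pos by (simp add: sumJ c_def power_divide flip: sum_divide_distrib)
    show "(\<Sum>m\<in>J. (w i m)\<^sup>2) = 1" for i
    proof (cases "n i = 0")
      case True
      then show ?thesis by (simp add: sumJ w_def if_distrib[where f = "\<lambda>y. y\<^sup>2"] cong: if_cong)
    next
      case False
      then show ?thesis by (simp add: sumJ w_def power_divide flip: sum_divide_distrib n2)
    qed
    show "(\<Sum>m\<in>J. w i m * w j m) = 0" if e: "{i, j} \<in> E" for i j
    proof -
      have "i \<noteq> j" using card2 e by fastforce
      then have "(\<Sum>l\<in>UNIV. w i (Inr l) * w j (Inr l)) = 0"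
        by (intro sum.neutral) (auto simp: w_def)
      moreover have "(\<Sum>m\<in>I. w i (Inl m) * w j (Inl m)) = 0"
        using orth[OF e] by (simp add: w_def flip: sum_divide_distrib)
      ultimately show ?thesis by (simp add: sumJ)
    qed
  qed
  moreover have "t \<le> s"
  proof -
    have nc: "n i * (\<Sum>m\<in>J. c m * w i m) = (\<Sum>m\<in>I. (\<Sum>j\<in>UNIV. v j m) * v i m) / sqrt t" for i
    proof (cases "n i = 0")
      case True
      then show ?thesis using n0[of i] by simp
    next
      case False
      then show ?thesis
        by (simp add: sumJ c_def w_def sum_distrib_left[of "n i"] sum_divide_distrib[of _ I])
    qed
    \<comment> \<open>The weights \<open>n i\<close> undo the normalisation, so this is the inner
      product of \<open>c\<close> with the sum of the \<open>v i\<close>, namely the length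
      \<open>sqrt t\<close> of that sum. Since the squares of the \<open>n i\<close> add up to 1,
      Cauchy-Schwarz then yields \<open>t \<le> s\<close>.\<close>
    have "(\<Sum>i\<in>UNIV. n i * (\<Sum>m\<in>J. c m * w i m)) = (\<Sum>i\<in>UNIV. \<Sum>m\<in>I. (\<Sum>j\<in>UNIV. v j m) * v i m) / sqrt t"
      by (simp add: nc sum_divide_distrib)
    also have "(\<Sum>i\<in>UNIV. \<Sum>m\<in>I. (\<Sum>j\<in>UNIV. v j m) * v i m) = t"
      unfolding t[symmetric] power2_eq_square
      by (subst sum.swap) (simp add: sum_distrib_left)
    finally have "(\<Sum>i\<in>UNIV. n i * (\<Sum>m\<in>J. c m * w i m)) = sqrt t"
      using t_pos by (simp add: real_div_sqrt)
    then have "t = (\<Sum>i\<in>UNIV. n i * (\<Sum>m\<in>J. c m * w i m))\<^sup>2"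
      using t_pos by simp
    also have "\<dots> \<le> (\<Sum>i\<in>UNIV. (n i)\<^sup>2) * s"
      unfolding s_def by (rule Cauchy_Schwarz_ineq_sum)
    also have "\<dots> = s"
      using tr by (simp add: n2)
    finally show ?thesis .
  qed
  ultimately show thesis by (rule that)
qed

section \<open>Strong duality by separation\<close>

text \<open>The constraints and the objective of the dual program, evaluated at the rank-one matrix
  of products \<open>x $ i * x $ j\<close>. Convex combinations over the sphere thus range over the
  positive semidefinite matrices of trace 1.\<close>

definition edge_form :: "'v::finite set set \<Rightarrow> real^'v \<Rightarrow> (real^'v^'v) \<times> real" where
  "edge_form E x = ((\<chi> i j. if {i, j} \<in> E then x $ i * x $ j else 0), (\<Sum>i\<in>UNIV. x $ i)\<^sup>2)"

lemma compact_edge_form_sphere: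
  "compact (edge_form E ` sphere 0 1)"
  unfolding edge_form_def
proof (rule compact_continuous_image)
  have "continuous_on (sphere 0 1) (\<lambda>x :: real^'a. if {i, j} \<in> E then x $ i * x $ j else 0)" for i j
    by (cases "{i, j} \<in> E") (auto intro!: continuous_intros)
  then show "continuous_on (sphere 0 1) (\<lambda>x :: real^'a.
      ((\<chi> i j. if {i, j} \<in> E then x $ i * x $ j else 0), (\<Sum>i\<in>UNIV. x $ i)\<^sup>2))"
    by (intro continuous_intros)
qed simp

lemma sum_squares_sphere:
  assumes "(x :: real^'v) \<in> sphere 0 1"
  shows "(\<Sum>i\<in>UNIV. (x $ i)\<^sup>2) = 1"
  using assms by (simp add: norm_vec_def L2_set_def)

text \<open>The functional is the quadratic form of J + A, where J is all ones and A is the edge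
  part of \<open>a\<close>. The bound says that the eigenvalues of its symmetrisation are at most
  \<open>t\<close>, so tI - J - A, symmetrised, is feasible.\<close>

lemma theta_values_of_linear_bound:
  fixes E :: "'v::finite set set" and a :: "real^'v^'v"
  assumes card2: "\<forall>e\<in>E. card e = 2"
    and le: "\<And>x. x \<in> sphere 0 1 \<Longrightarrow> inner (a, 1) (edge_form E x) \<le> t"
  shows "t \<in> theta_values E"
proof -
  define Z :: "real^'v^'v" where "Z = (\<chi> i j. (if i = j then t else 0) - 1
    - (if {i, j} \<in> E then (a $ i $ j + a $ j $ i) / 2 else 0))"
  have no_loop: "{i} \<notin> E" for i
    using card2 by force
  have quad_Z: "quad Z (vec_nth x) = t * (\<Sum>i\<in>UNIV. (x $ i)\<^sup>2) - inner (a, 1) (edge_form E x)" for x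
  proof -
    let ?b = "\<lambda>i j. if {i, j} \<in> E then a $ i $ j * (x $ i * x $ j) else 0"
    have "quad Z (vec_nth x) = (\<Sum>i\<in>UNIV. \<Sum>j\<in>UNIV. (if i = j then t * (x $ i)\<^sup>2 else 0)
        - x $ i * x $ j - (?b i j / 2 + ?b j i / 2))"
      unfolding quad_def Z_def
      by (intro sum.cong refl) (auto simp: algebra_simps power2_eq_square insert_commute add_divide_distrib)
    also have "\<dots> = t * (\<Sum>i\<in>UNIV. (x $ i)\<^sup>2) - (\<Sum>i\<in>UNIV. x $ i)\<^sup>2
        - ((\<Sum>i\<in>UNIV. \<Sum>j\<in>UNIV. ?b i j / 2) + (\<Sum>i\<in>UNIV. \<Sum>j\<in>UNIV. ?b j i / 2))"
      unfolding sum_subtractf sum.distrib power2_eq_square sum_product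
      by (simp add: sum_distrib_left)
    also have "(\<Sum>i\<in>UNIV. \<Sum>j\<in>UNIV. ?b j i / 2) = (\<Sum>i\<in>UNIV. \<Sum>j\<in>UNIV. ?b i j / 2)"
      by (rule sum.swap)
    also have "(\<Sum>i\<in>UNIV. \<Sum>j\<in>UNIV. ?b i j / 2) + (\<Sum>i\<in>UNIV. \<Sum>j\<in>UNIV. ?b i j / 2)
        = (\<Sum>i\<in>UNIV. \<Sum>j\<in>UNIV. ?b i j)"
      by (simp flip: sum_divide_distrib)
    also have "\<dots> = (\<Sum>i\<in>UNIV. \<Sum>j\<in>UNIV. a $ i $ j * (if {i, j} \<in> E then x $ i * x $ j else 0))"
      by (intro sum.cong refl) simp
    finally show ?thesis
      by (simp add: edge_form_def inner_vec_def)
  qed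
  have "0 \<le> quad Z y" for y
  proof -
    define x :: "real^'v" where "x = (\<chi> i. y i)"
    have y: "y = vec_nth x" by (simp add: x_def fun_eq_iff)
    show ?thesis
    proof (cases "x = 0")
      case True
      then show ?thesis by (simp add: y quad_def)
    next
      case False
      \<comment> \<open>The bound is known only on the sphere; \<open>quad\<close> is homogeneous of
        degree 2.\<close>
      define z where "z = x /\<^sub>R norm x"
      have z: "z \<in> sphere 0 1" using False by (simp add: z_def)
      then have "0 \<le> quad Z (vec_nth z)"
        using le[OF z] sum_squares_sphere[OF z] quad_Z[of z] by simp
      moreover have "quad Z (vec_nth x) = (norm x)\<^sup>2 * quad Z (vec_nth z)"
        using False by (simp add: quad_def z_def sum_distrib_left power2_eq_square field_simps)
      ultimately show ?thesis by (simp add: y)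
    qed
  qed
  then have "pos_semidef Z"
    by (auto simp: pos_semidef_iff_quad Z_def insert_commute add.commute)
  then show ?thesis
    unfolding theta_values_def using no_loop by (auto intro!: exI[of _ Z] simp: Z_def)
qed

lemma minimum_in_convex_hull:
  fixes E :: "'v::finite set set"
  assumes card2: "\<forall>e\<in>E. card e = 2" and min: "is_minimum (theta_values E) t"
  shows "(0, t) \<in> convex hull (edge_form E ` sphere 0 1)"
proof (rule ccontr)
  assume "(0, t) \<notin> convex hull (edge_form E ` sphere 0 1)"
  moreover have "closed (convex hull (edge_form E ` sphere 0 1))"
    by (intro compact_imp_closed compact_convex_hull compact_edge_form_sphere)
  ultimately obtain p b where p: "inner p (0, t) < b"
    and sep: "\<And>y. y \<in> convex hull (edge_form E ` sphere 0 1) \<Longrightarrow> b < inner p y"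
    using separating_hyperplane_closed_point[OF convex_convex_hull] by metis
  obtain a d where ad: "p = (a, d)" by (cases p)
  have bound: "b < inner a (fst (edge_form E x)) + d * snd (edge_form E x)" if "x \<in> sphere 0 1" for x
    using sep[OF hull_inc[OF imageI[OF that]]] by (cases "edge_form E x") (simp add: ad)
  have t1: "1 \<le> t" using min theta_values_ge_1 by (auto simp: is_minimum_def)
  have "d * t < b" using p by (simp add: ad)
  \<comment> \<open>A basis vector is mapped to \<open>(0, 1)\<close>, as there are no loops.
    Together with \<open>d * t < b\<close> and \<open>1 \<le> t\<close> this fixes the sign of
    \<open>d\<close>.\<close>
  moreover have "b < d"
  proof -
    fix q :: 'v
    have no_loop: "{q} \<notin> E"
      using card2 by force
    have "edge_form E (axis q 1) = (0, 1)"
      using no_loop by (auto simp: edge_form_def axis_def Finite_Cartesian_Product.vec_eq_iff)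
    then show ?thesis using bound[of "axis q 1"] by (simp add: norm_axis_1)
  qed
  ultimately have "d * (t - 1) < 0" by (simp add: algebra_simps)
  then have d: "d < 0" using t1 by (simp add: mult_less_0_iff)
  \<comment> \<open>Dividing by the negative \<open>d\<close> reverses the separating inequality and
    normalises the last coefficient to 1; the resulting value \<open>b / d\<close> undercuts the
    minimum \<open>t\<close>.\<close>
  have "b / d \<in> theta_values E"
  proof (rule theta_values_of_linear_bound[OF card2])
    fix x :: "real^'v" assume "x \<in> sphere 0 1"
    then have "(inner a (fst (edge_form E x)) + d * snd (edge_form E x)) / d \<le> b / d"
      using bound d by (intro divide_right_mono_neg less_imp_le) auto
    moreover have "inner (a /\<^sub>R d, 1) (edge_form E x)
        = (inner a (fst (edge_form E x)) + d * snd (edge_form E x)) / d"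
      using d by (cases "edge_form E x") (simp add: field_simps)
    ultimately show "inner (a /\<^sub>R d, 1) (edge_form E x) \<le> b / d"
      by (simp only:)
  qed
  moreover have "b / d < t"
    using \<open>d * t < b\<close> d by (simp add: field_simps)
  ultimately show False
    using min by (fastforce simp: is_minimum_def)
qed

lemma theta_ell_values_ge_minimum:
  fixes E :: "'v::finite set set"
  assumes card2: "\<forall>e\<in>E. card e = 2" and min: "is_minimum (theta_values E) t"
  obtains s where "s \<in> theta_ell_values E" and "t \<le> s"
proof -
  obtain k l y where l: "\<And>m. m \<in> {1..k::nat} \<Longrightarrow> 0 \<le> l m"
    and y: "\<And>m. m \<in> {1..k} \<Longrightarrow> y m \<in> edge_form E ` sphere 0 1"
    and l1: "sum l {1..k} = 1" and eq: "(\<Sum>m = 1..k. l m *\<^sub>R y m) = (0, t)"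
    using minimum_in_convex_hull[OF assms] unfolding convex_hull_indexed mem_Collect_eq by blast
  obtain x where x: "\<And>m. m \<in> {1..k} \<Longrightarrow> x m \<in> sphere 0 1"
    and yx: "\<And>m. m \<in> {1..k} \<Longrightarrow> y m = edge_form E (x m)"
    using y unfolding image_iff by metis
  \<comment> \<open>The Gram matrix of the \<open>v i\<close> is the convex combination of the
    rank-one matrices of the \<open>x m\<close>. Its trace is 1, its edge entries vanish by
    \<open>fst0\<close>, and its entries sum to \<open>t\<close> by \<open>snd0\<close>.\<close>
  define v where "v i m = sqrt (l m) * x m $ i" for i m
  have sqrt2: "sqrt (l m) * sqrt (l m) = l m" "(sqrt (l m))\<^sup>2 = l m" if "m \<in> {1..k}" for m
    using l[OF that] by auto
  have "(\<Sum>m = 1..k. l m *\<^sub>R edge_form E (x m)) = (0, t)"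
    using eq yx by simp
  then have fst0: "(\<Sum>m = 1..k. l m *\<^sub>R fst (edge_form E (x m))) = 0"
    and snd0: "(\<Sum>m = 1..k. l m * snd (edge_form E (x m))) = t"
    by (auto simp: prod_eq_iff fst_sum snd_sum)
  show thesis
  proof (rule theta_ell_values_of_gram[OF card2, of "{1..k}" v t])
    have "(\<Sum>i\<in>UNIV. \<Sum>m = 1..k. (v i m)\<^sup>2) = (\<Sum>m = 1..k. \<Sum>i\<in>UNIV. (v i m)\<^sup>2)"
      by (rule sum.swap)
    also have "\<dots> = (\<Sum>m = 1..k. l m * (\<Sum>i\<in>UNIV. (x m $ i)\<^sup>2))"
      by (intro sum.cong refl) (simp add: v_def power_mult_distrib sqrt2 sum_distrib_left)
    also have "\<dots> = 1"
      using l1 by (simp add: sum_squares_sphere[OF x] del: mem_sphere mem_sphere_0)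
    finally show "(\<Sum>i\<in>UNIV. \<Sum>m = 1..k. (v i m)\<^sup>2) = 1" .
    show "(\<Sum>m = 1..k. v i m * v j m) = 0" if "{i, j} \<in> E" for i j
    proof -
      have "(\<Sum>m = 1..k. v i m * v j m)
          = (\<Sum>m = 1..k. (sqrt (l m) * sqrt (l m)) * (x m $ i * x m $ j))"
        by (simp only: v_def mult_ac)
      also have "\<dots> = (\<Sum>m = 1..k. l m * (x m $ i * x m $ j))"
        by (intro sum.cong refl) (simp only: sqrt2)
      also have "\<dots> = (\<Sum>m = 1..k. l m *\<^sub>R fst (edge_form E (x m))) $ i $ j"
        using that by (simp add: edge_form_def)
      finally show ?thesis unfolding fst0 by simp
    qed
    have "(\<Sum>m = 1..k. (\<Sum>i\<in>UNIV. v i m)\<^sup>2) = (\<Sum>m = 1..k. l m * (\<Sum>i\<in>UNIV. x m $ i)\<^sup>2)"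
      by (intro sum.cong refl) (simp add: v_def power_mult_distrib sqrt2 flip: sum_distrib_left)
    then show "(\<Sum>m = 1..k. (\<Sum>i\<in>UNIV. v i m)\<^sup>2) = t"
      using snd0 by (simp add: edge_form_def)
    show "0 < t"
      using min theta_values_ge_1 by (fastforce simp: is_minimum_def)
  qed (use that in auto)
qed

theorem proposition1:
  fixes E :: "'v::finite set set"
  assumes "\<forall>e\<in>E. card e = 2"
  shows "is_maximum (theta_ell_values E) (theta_ell E) \<and>
         is_minimum (theta_values E) (lovasz_theta E) \<and>
         theta_ell E = lovasz_theta E"
proof -
  obtain t where min: "is_minimum (theta_values E) t"
    by (rule theta_values_has_minimum)
  then obtain s where s: "s \<in> theta_ell_values E" "t \<le> s"
    by (rule theta_ell_values_ge_minimum[OF assms])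
  have weak: "s' \<le> t" if "s' \<in> theta_ell_values E" for s'
    using theta_ell_le_theta that min by (auto simp: is_minimum_def)
  \<comment> \<open>Attainment comes from \<open>s\<close> itself: weak duality forces
    \<open>s = t\<close>.\<close>
  have max: "is_maximum (theta_ell_values E) t"
    using s weak[OF s(1)] weak by (simp add: is_maximum_def)
  have "theta_ell E = t"
    unfolding theta_ell_def using max by (intro Greatest_equality) (auto simp: is_maximum_def)
  moreover have "lovasz_theta E = t"
    unfolding lovasz_theta_def using min by (intro Least_equality) (auto simp: is_minimum_def)
  ultimately show ?thesis
    using max min by simp
qed

end
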